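(* There is an absolute constant $C>0$ such that the following holds. Let $0<\rho<\frac14$ be a constant, let $\beta>1$ and $\delta>0$, and set $q:=1-\frac{1}{\sqrt\beta}$. For $\varepsilon>0$ put $$N_\varepsilon:=C\cdot\frac{\log\!\left(\frac{1}{\delta\varepsilon q}\right)}{\rho q^2}.$$ Let $X=\{x_1,\dots,x_N\}$ with $x_1,\dots,x_N$ i.i.d. uniform on $[0,1]$ (with distance $d(x,y)=|x-y|$), and let $k(\varepsilon)$ be the number of clusters produced by DBSCAN on $X$ with radius $\varepsilon$ and $MinPts=\rho\cdot N$, where $\rho N$ is an integer at least $2$. Then both of the following hold: 1. for any $\varepsilon>\beta\cdot\frac{\rho}{2}$ and any $N>N_\varepsilon$, $P_X[k(\varepsilon)=1]>1-\delta$; 2. for any $0<\varepsilon<\frac1\beta\cdot\frac{\rho}{2}$ and any $N>N_\varepsilon$, $P_X[k(\varepsilon)=0]>1-\delta$.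
   Context: DBSCAN: let $X$ be a finite set of points in a metric space with distance $d$, and let $\varepsilon>0$ and an integer $MinPts\ge 2$ be parameters. For $p\in X$ put $N_\varepsilon(p)=\{y\in X: d(p,y)\le\varepsilon\}$ (this includes $p$ itself). A point $p\in X$ is a core point if $|N_\varepsilon(p)|\ge MinPts$. A non-core point lying within distance $\varepsilon$ of some core point is a border point; all other non-core points are noise. Points $p,q\in X$ are density-reachable if there is a sequence $p=p_1,\dots,p_t=q$ in $X$ with $p_i$ a core point for all $i<t$ and $d(p_i,p_{i+1})\le\varepsilon$ for all $i<t$. A cluster is a maximal set of points that contains at least one core point, whose core points are mutually density-reachable, and whose non-core points are within $\varepsilon$ of a core point of the set. Noise points belong to no cluster. Hence the number of clusters $k(\varepsilon)$ equals the number of classes of core points under mutual density-reachability (and is $0$ if there are no core points). *)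

theory Defs
  imports "HOL-Probability.Probability"
begin

definition eps_nbhd :: "'a::metric_space set \<Rightarrow> real \<Rightarrow> 'a \<Rightarrow> 'a set" where
  "eps_nbhd X \<epsilon> p = {y \<in> X. dist p y \<le> \<epsilon>}"

definition core_point :: "'a::metric_space set \<Rightarrow> real \<Rightarrow> nat \<Rightarrow> 'a \<Rightarrow> bool" where
  "core_point X \<epsilon> MinPts p \<longleftrightarrow> p \<in> X \<and> card (eps_nbhd X \<epsilon> p) \<ge> MinPts"

text \<open>Directed: every point of the chain except possibly the last one is a core point.\<close>

definition density_reachable ::
    "'a::metric_space set \<Rightarrow> real \<Rightarrow> nat \<Rightarrow> 'a \<Rightarrow> 'a \<Rightarrow> bool" where
  "density_reachable X \<epsilon> MinPts p q \<longleftrightarrow>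
     (\<exists>(t::nat) (s :: nat \<Rightarrow> 'a). t \<ge> 1 \<and> s 1 = p \<and> s t = q \<and> (\<forall>i\<in>{1..t}. s i \<in> X) \<and>
        (\<forall>i\<in>{1..<t}. core_point X \<epsilon> MinPts (s i) \<and> dist (s i) (s (i + 1)) \<le> \<epsilon>))"

definition precluster :: "'a::metric_space set \<Rightarrow> real \<Rightarrow> nat \<Rightarrow> 'a set \<Rightarrow> bool" where
  "precluster X \<epsilon> MinPts S \<longleftrightarrow>
     S \<subseteq> X \<and>
     (\<exists>p\<in>S. core_point X \<epsilon> MinPts p) \<and>
     (\<forall>p\<in>S. \<forall>q\<in>S. core_point X \<epsilon> MinPts p \<and> core_point X \<epsilon> MinPts q \<longrightarrow>
        density_reachable X \<epsilon> MinPts p q \<and> density_reachable X \<epsilon> MinPts q p) \<and>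
     (\<forall>p\<in>S. \<not> core_point X \<epsilon> MinPts p \<longrightarrow>
        (\<exists>c\<in>S. core_point X \<epsilon> MinPts c \<and> dist p c \<le> \<epsilon>))"

text \<open>A cluster is an inclusion-maximal precluster. A border point may lie in several clusters.\<close>

definition dbscan_cluster :: "'a::metric_space set \<Rightarrow> real \<Rightarrow> nat \<Rightarrow> 'a set \<Rightarrow> bool" where
  "dbscan_cluster X \<epsilon> MinPts S \<longleftrightarrow>
     precluster X \<epsilon> MinPts S \<and> (\<forall>T. precluster X \<epsilon> MinPts T \<and> S \<subseteq> T \<longrightarrow> T = S)"

definition num_clusters :: "'a::metric_space set \<Rightarrow> real \<Rightarrow> nat \<Rightarrow> nat" where
  "num_clusters X \<epsilon> MinPts = card {S. dbscan_cluster X \<epsilon> MinPts S}"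

text \<open>Joint law of \<open>x\<^sub>1, \<dots>, x\<^sub>N\<close>, independent and uniform on \<open>[0,1]\<close>.\<close>

definition unif_sample :: "nat \<Rightarrow> (nat \<Rightarrow> real) measure" where
  "unif_sample N = PiM {1..N} (\<lambda>_. uniform_measure lborel {0..1})"

text \<open>The threshold \<open>N\<^sub>\<epsilon>\<close>; it is real-valued and may be negative for large \<open>\<epsilon>\<close> or \<open>\<delta>\<close>.\<close>

definition sample_bound :: "real \<Rightarrow> real \<Rightarrow> real \<Rightarrow> real \<Rightarrow> real \<Rightarrow> real" where
  "sample_bound C \<rho> q \<delta> \<epsilon> = C * (ln (1 / (\<delta> * \<epsilon> * q)) / (\<rho> * q\<^sup>2))"

end

theory Submission
  imports Defs
begin

text \<open>
  On the line the core points form a single class iff no core point is followed by a gap longer than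
  \<open>\<epsilon>\<close> before the next core point; this also makes the events measurable. A multiplicative Chernoff
  bound over a grid of about \<open>1 / (\<epsilon> q)\<close> windows controls, up to probability \<open>(\<delta> \<epsilon> q)^8 / (\<epsilon> q)\<close>,
  the number of sample points in every interval of the relevant length. If \<open>\<epsilon>\<close> is below the threshold,
  no interval of length \<open>2\<epsilon>\<close> is populated enough to produce a core point. If it is above and
  \<open>\<epsilon> \<le> 1/2\<close>, all points of \<open>[\<epsilon>(1 - q), 1 - \<epsilon>(1 - q)]\<close> are core points and are dense enough to
  bridge every gap. For \<open>\<epsilon> \<ge> 1/2\<close> the assumption \<open>\<rho> < 1/4\<close> makes every point a core point, unless
  \<open>\<delta> \<epsilon> q > 2/3\<close>: then \<open>N\<^sub>\<epsilon>\<close> is too small for concentration, but a single sample point in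
  \<open>[1 - \<epsilon>, \<epsilon>]\<close>, which is adjacent to everything, suffices.
\<close>

section \<open>Clusters and gaps between core points\<close>

text \<open>One step of a chain as a relation, so that closure induction can replace indexed chains.
  Only the source has to be a core point, which keeps the asymmetry of density-reachability.\<close>

definition reach_step :: "'a::metric_space set \<Rightarrow> real \<Rightarrow> nat \<Rightarrow> 'a \<Rightarrow> 'a \<Rightarrow> bool" where
  "reach_step X \<epsilon> m p q \<longleftrightarrow> core_point X \<epsilon> m p \<and> q \<in> X \<and> dist p q \<le> \<epsilon>"

text \<open>The closure is reflexive at every point, whereas a one-term chain still has to lie in
  \<open>X\<close>; hence the hypothesis on \<open>p\<close>.\<close>

lemma density_reachable_iff:
  assumes "p \<in> X"
  shows "density_reachable X \<epsilon> m p q \<longleftrightarrow> (reach_step X \<epsilon> m)\<^sup>*\<^sup>* p q"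
proof
  assume "density_reachable X \<epsilon> m p q"
  then obtain t :: nat and s where t: "t \<ge> 1" "s 1 = p" "s t = q" "\<forall>i\<in>{1..t}. s i \<in> X"
    "\<forall>i\<in>{1..<t}. core_point X \<epsilon> m (s i) \<and> dist (s i) (s (i + 1)) \<le> \<epsilon>"
    unfolding density_reachable_def by blast
  have "(reach_step X \<epsilon> m)\<^sup>*\<^sup>* p (s (Suc k))" if "Suc k \<le> t" for k
    using that
  proof (induction k)
    case 0
    then show ?case using t(2) by simp
  next
    case (Suc k)
    then have "reach_step X \<epsilon> m (s (Suc k)) (s (Suc (Suc k)))"
      using t(4,5) by (auto simp: reach_step_def)
    with Suc show ?case by (meson Suc_leD rtranclp.rtrancl_into_rtrancl)
  qed
  from this[of "t - 1"] t show "(reach_step X \<epsilon> m)\<^sup>*\<^sup>* p q" by simp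
next
  assume "(reach_step X \<epsilon> m)\<^sup>*\<^sup>* p q"
  then show "density_reachable X \<epsilon> m p q"
  proof (induction rule: rtranclp_induct)
    case base
    then show ?case unfolding density_reachable_def
      using assms by (intro exI[of _ 1] exI[of _ "\<lambda>_. p"]) auto
  next
    case (step y z)
    then obtain t :: nat and s where t: "t \<ge> 1" "s 1 = p" "s t = y" "\<forall>i\<in>{1..t}. s i \<in> X"
      "\<forall>i\<in>{1..<t}. core_point X \<epsilon> m (s i) \<and> dist (s i) (s (i + 1)) \<le> \<epsilon>"
      unfolding density_reachable_def by blast
    have "i < t \<or> i = t" if "i < Suc t" for i using that by auto
    with t step(2) show ?case unfolding density_reachable_def reach_step_def
      by (intro exI[of _ "Suc t"] exI[of _ "s(Suc t := z)"])
         (auto simp: le_Suc_eq less_Suc_eq)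
  qed
qed

lemma precluster_extends_to_cluster:
  assumes "finite X" "precluster X \<epsilon> m S"
  obtains T where "dbscan_cluster X \<epsilon> m T" "S \<subseteq> T"
proof -
  have "finite {T. precluster X \<epsilon> m T}"
    by (rule finite_subset[of _ "Pow X"]) (auto simp: precluster_def assms(1))
  from finite_has_maximal2[OF this, of S] assms(2) obtain T where
    "precluster X \<epsilon> m T" "S \<subseteq> T" "\<forall>U. precluster X \<epsilon> m U \<longrightarrow> T \<subseteq> U \<longrightarrow> T = U" by auto
  with that show ?thesis by (metis dbscan_cluster_def)
qed

lemma core_point_singleton_precluster:
  assumes "core_point X \<epsilon> m p"
  shows "precluster X \<epsilon> m {p}"
proof -
  have "p \<in> X" using assms by (simp add: core_point_def)
  then have "density_reachable X \<epsilon> m p p" by (simp add: density_reachable_iff)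
  then show ?thesis using assms \<open>p \<in> X\<close> by (auto simp: precluster_def)
qed

lemma finite_clusters: "finite X \<Longrightarrow> finite {S. dbscan_cluster X \<epsilon> m S}"
  by (rule finite_subset[of _ "Pow X"]) (auto simp: dbscan_cluster_def precluster_def)

text \<open>Finiteness enters twice: an infinite family would also have \<open>card\<close> 0, and
  growing the singleton of a core point to a maximal precluster relies on it.\<close>

lemma num_clusters_eq_0_iff:
  assumes "finite X"
  shows "num_clusters X \<epsilon> m = 0 \<longleftrightarrow> (\<forall>p. \<not> core_point X \<epsilon> m p)"
proof -
  have "num_clusters X \<epsilon> m = 0 \<longleftrightarrow> (\<forall>S. \<not> dbscan_cluster X \<epsilon> m S)"
    by (simp add: num_clusters_def finite_clusters[OF assms])
  also have "\<dots> \<longleftrightarrow> (\<forall>p. \<not> core_point X \<epsilon> m p)"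
    by (metis assms core_point_singleton_precluster dbscan_cluster_def precluster_def
        precluster_extends_to_cluster)
  finally show ?thesis .
qed

text \<open>Left to right: each core point lies in a cluster grown from its singleton, hence in the
  only one. Right to left: the core and border points together form a precluster that contains every
  other.\<close>

lemma num_clusters_eq_1_iff:
  assumes "finite X"
  shows "num_clusters X \<epsilon> m = 1 \<longleftrightarrow> (\<exists>p. core_point X \<epsilon> m p) \<and>
    (\<forall>p q. core_point X \<epsilon> m p \<longrightarrow> core_point X \<epsilon> m q \<longrightarrow> density_reachable X \<epsilon> m p q)"
    (is "_ \<longleftrightarrow> ?ex \<and> ?conn")
proof
  assume 1: "num_clusters X \<epsilon> m = 1"
  then obtain S where S: "{S. dbscan_cluster X \<epsilon> m S} = {S}"
    unfolding num_clusters_def using card_1_singletonE by blast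
  have mem: "p \<in> S" if "core_point X \<epsilon> m p" for p
    using precluster_extends_to_cluster[OF assms core_point_singleton_precluster[OF that]] S
    by (metis insert_subset mem_Collect_eq singletonD)
  have "precluster X \<epsilon> m S" using S by (auto simp: dbscan_cluster_def)
  then show "?ex \<and> ?conn" using mem by (auto simp: precluster_def)
next
  assume conn: "?ex \<and> ?conn"
  define U where "U = {p \<in> X. core_point X \<epsilon> m p \<or> (\<exists>c. core_point X \<epsilon> m c \<and> dist p c \<le> \<epsilon>)}"
  have core: "core_point X \<epsilon> m p \<Longrightarrow> p \<in> U" for p by (auto simp: U_def core_point_def)
  have U: "precluster X \<epsilon> m U"
    unfolding precluster_def using conn core by (auto simp: U_def)
  have "S \<subseteq> U" if "precluster X \<epsilon> m S" for S
    using that unfolding precluster_def U_def by blast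
  with U have "{S. dbscan_cluster X \<epsilon> m S} = {U}"
    unfolding dbscan_cluster_def by blast
  then show "num_clusters X \<epsilon> m = 1" by (simp add: num_clusters_def)
qed

text \<open>A chain that gets past \<open>p\<close> must cross it in one step of length at most
  \<epsilon>, and it lands on a core point. Conversely, hopping to the right between core points
  reaches \<open>q\<close> after finitely many steps, and each hop can be reversed because both its
  ends are core.\<close>

lemma real_core_points_connected_iff:
  fixes X :: "real set"
  assumes "finite X"
  shows "(\<forall>p q. core_point X \<epsilon> m p \<longrightarrow> core_point X \<epsilon> m q \<longrightarrow> density_reachable X \<epsilon> m p q) \<longleftrightarrow>
    (\<forall>p q. core_point X \<epsilon> m p \<longrightarrow> core_point X \<epsilon> m q \<longrightarrow> p < q \<longrightarrow>
      (\<exists>r. core_point X \<epsilon> m r \<and> p < r \<and> r \<le> p + \<epsilon>))" (is "?conn \<longleftrightarrow> ?gap")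
proof
  assume conn: ?conn
  \<comment> \<open>The start is relaxed from \<open>p\<close> to any \<open>a \<le> p\<close>,
    since a chain may wander to the left before it crosses \<open>p\<close>.\<close>
  have main: "\<exists>r. core_point X \<epsilon> m r \<and> p < r \<and> r \<le> p + \<epsilon>"
    if "(reach_step X \<epsilon> m)\<^sup>*\<^sup>* a q" "core_point X \<epsilon> m q" "a \<le> p" "p < q" for a p q
    using that
  proof (induction rule: converse_rtranclp_induct)
    case base
    then show ?case by simp
  next
    case (step a b)
    \<comment> \<open>\<open>b\<close> is core because it is either \<open>q\<close> or the source
      of the next step.\<close>
    have "core_point X \<epsilon> m b" using step(2,4)
      by (cases rule: converse_rtranclpE) (auto simp: reach_step_def)
    moreover have "b \<le> a + \<epsilon>" using step(1) by (auto simp: reach_step_def dist_real_def)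
    ultimately show ?case using step by (cases "b \<le> p") (auto intro!: exI[of _ b])
  qed
  show ?gap
  proof (intro allI impI)
    fix p q assume "core_point X \<epsilon> m p" "core_point X \<epsilon> m q" "p < q"
    then show "\<exists>r. core_point X \<epsilon> m r \<and> p < r \<and> r \<le> p + \<epsilon>"
      using main[of p q p] conn density_reachable_iff[of p X \<epsilon> m q] by (auto simp: core_point_def)
  qed
next
  assume gap: ?gap
  have main: "(reach_step X \<epsilon> m)\<^sup>*\<^sup>* p q \<and> (reach_step X \<epsilon> m)\<^sup>*\<^sup>* q p"
    if "core_point X \<epsilon> m p" "core_point X \<epsilon> m q" "p < q" for p q
    using that
  proof (induction "card {r \<in> X. p < r \<and> r \<le> q}" arbitrary: p rule: less_induct)
    case less
    \<comment> \<open>If the hop given by \<open>gap\<close> overshoots \<open>q\<close>, then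
      \<open>q\<close> itself is within \<epsilon> and serves as \<open>r\<close>.\<close>
    obtain r where r: "core_point X \<epsilon> m r" "p < r" "r \<le> p + \<epsilon>" "r \<le> q"
      using gap less.prems by (metis dual_order.trans linorder_le_cases)
    have X: "p \<in> X" "r \<in> X" using less.prems r by (auto simp: core_point_def)
    have step: "reach_step X \<epsilon> m p r" "reach_step X \<epsilon> m r p"
      using less.prems r X by (auto simp: reach_step_def dist_real_def)
    show ?case
    proof (cases "r = q")
      case True
      then show ?thesis using step by auto
    next
      case False
      have "card {a \<in> X. r < a \<and> a \<le> q} < card {a \<in> X. p < a \<and> a \<le> q}"
        by (rule psubset_card_mono) (use assms r X in auto)
      from less.hyps[OF this r(1) less.prems(2)] False r(4) step
      show ?thesis
        by (meson converse_rtranclp_into_rtranclp less_eq_real_def rtranclp.rtrancl_into_rtrancl)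
    qed
  qed
  show ?conn
  proof (intro allI impI)
    fix p q assume "core_point X \<epsilon> m p" "core_point X \<epsilon> m q"
    then show "density_reachable X \<epsilon> m p q"
      using main[of p q] main[of q p] density_reachable_iff[of p X \<epsilon> m q]
      by (cases p q rule: linorder_cases) (auto simp: core_point_def)
  qed
qed

text \<open>Each quantifier is moved next to its own core point guard, the shape in which it can
  later be turned into a quantifier over indices.\<close>

lemma num_clusters_real_eq_1_iff:
  fixes X :: "real set"
  assumes "finite X"
  shows "num_clusters X \<epsilon> m = 1 \<longleftrightarrow> (\<exists>p. core_point X \<epsilon> m p) \<and>
    (\<forall>p. core_point X \<epsilon> m p \<longrightarrow> (\<forall>q. core_point X \<epsilon> m q \<longrightarrow> p < q \<longrightarrow>
      (\<exists>r. core_point X \<epsilon> m r \<and> p < r \<and> r \<le> p + \<epsilon>)))"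
  unfolding num_clusters_eq_1_iff[OF assms] real_core_points_connected_iff[OF assms]
  by (simp only: all_simps)

section \<open>The uniform sample\<close>

abbreviation unif01 :: "real measure" where
  "unif01 \<equiv> uniform_measure lborel {0..1}"

interpretation unif01: prob_space unif01
  by (rule prob_space_uniform_measure) auto

interpretation unif01_prod: product_prob_space "\<lambda>_::nat. unif01" I for I
  by standard

lemma prob_space_unif_sample: "prob_space (unif_sample N)"
  unfolding unif_sample_def by (rule unif01_prod.prob_space_axioms)

lemma measurable_unif_sample_component:
  "i \<in> {1..N} \<Longrightarrow> (\<lambda>x. x i) \<in> borel_measurable (unif_sample N)"
  unfolding unif_sample_def by (simp add: measurable_PiM_component_rev)

lemma distr_unif_sample_component:
  "i \<in> {1..N} \<Longrightarrow> distr (unif_sample N) unif01 (\<lambda>x. x i) = unif01"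
  unfolding unif_sample_def
  by (rule distr_PiM_component) (auto intro: unif01.prob_space_axioms)

lemma AE_unif_sample_range: "AE x in unif_sample N. \<forall>i\<in>{1..N}. x i \<in> {0..1}"
proof -
  have "AE x in unif_sample N. x i \<in> {0..1}" if "i \<in> {1..N}" for i
    unfolding unif_sample_def using that
    by (intro AE_PiM_component unif01.prob_space_axioms AE_uniform_measureI) auto
  then show ?thesis by (simp add: AE_ball_countable)
qed

text \<open>DBSCAN sees only the set of values, so ties would lose points. Two distinct coordinates
  are independent, so their joint law is a product, and the diagonal is null because every slice of
  it is a single point.\<close>

lemma AE_unif_sample_inj: "AE x in unif_sample N. inj_on x {1..N}"
proof -
  have "AE x in unif_sample N. x i \<noteq> x j" if ij: "i \<in> {1..N}" "j \<in> {1..N}" "i \<noteq> j" for i j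
  proof -
    interpret S: prob_space "unif_sample N" by (rule prob_space_unif_sample)
    \<comment> \<open>The restricted tuple of coordinates is the sample itself, so its law is a
      product and the coordinates are independent.\<close>
    have "distr (unif_sample N) (PiM {1..N} (\<lambda>_. unif01)) (\<lambda>x. \<lambda>i\<in>{1..N}. x i)
        = distr (unif_sample N) (unif_sample N) (\<lambda>x. x)"
      by (rule distr_cong) (auto simp: unif_sample_def space_PiM)
    also have "\<dots> = PiM {1..N} (\<lambda>i. distr (unif_sample N) unif01 (\<lambda>x. x i))"
      unfolding distr_id2[OF refl] by (subst PiM_cong[OF refl distr_unif_sample_component]) (auto simp: unif_sample_def)
    finally have "S.indep_vars (\<lambda>_. unif01) (\<lambda>i x. x i) {1..N}"
      using ij by (subst S.indep_vars_iff_distr_eq_PiM') (auto simp: unif_sample_def)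
    then have "S.indep_var
        unif01 ((\<lambda>f. f i) \<circ> (\<lambda>x. restrict (\<lambda>i. x i) {i}))
        unif01 ((\<lambda>f. f j) \<circ> (\<lambda>x. restrict (\<lambda>i. x i) {j}))"
      using ij by (intro S.indep_var_compose[OF S.indep_var_restrict]) auto
    also have "((\<lambda>f. f i) \<circ> (\<lambda>x. restrict (\<lambda>i. x i) {i})) = (\<lambda>x::nat \<Rightarrow> real. x i)"
      by auto
    also have "((\<lambda>f. f j) \<circ> (\<lambda>x. restrict (\<lambda>i. x i) {j})) = (\<lambda>x::nat \<Rightarrow> real. x j)"
      by auto
    finally have "S.indep_var unif01 (\<lambda>x. x i) unif01 (\<lambda>x. x j)" .
    then have eq: "distr (unif_sample N) unif01 (\<lambda>x. x i) \<Otimes>\<^sub>M distr (unif_sample N) unif01 (\<lambda>x. x j)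
        = distr (unif_sample N) (unif01 \<Otimes>\<^sub>M unif01) (\<lambda>x. (x i, x j))"
      by (simp add: S.indep_var_distribution_eq)
    interpret pair_sigma_finite unif01 unif01 by standard
    have "AE y in unif01. a \<noteq> y" for a
    proof -
      have "AE y in lborel. a \<noteq> y" using AE_lborel_singleton[of a] by eventually_elim auto
      then show ?thesis by (intro AE_uniform_measureI) auto
    qed
    moreover have diag: "{z \<in> space (unif01 \<Otimes>\<^sub>M unif01). fst z \<noteq> snd z} \<in> sets (unif01 \<Otimes>\<^sub>M unif01)"
    proof (rule borel_measurable_neq)
      show "fst \<in> borel_measurable (unif01 \<Otimes>\<^sub>M unif01)" "snd \<in> borel_measurable (unif01 \<Otimes>\<^sub>M unif01)"
        using measurable_fst[of unif01 unif01] measurable_snd[of unif01 unif01] by auto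
    qed
    ultimately have "AE z in unif01 \<Otimes>\<^sub>M unif01. fst z \<noteq> snd z"
      by (intro AE_pair_measure) auto
    then have ae: "AE z in distr (unif_sample N) (unif01 \<Otimes>\<^sub>M unif01) (\<lambda>x. (x i, x j)). fst z \<noteq> snd z"
      by (simp only: eq[unfolded distr_unif_sample_component[OF ij(1)] distr_unif_sample_component[OF ij(2)], symmetric])
    have "(\<lambda>x. x k) \<in> measurable (unif_sample N) unif01" if "k \<in> {1..N}" for k
      unfolding unif_sample_def using that by (rule measurable_component_singleton)
    then have "(\<lambda>x. (x i, x j)) \<in> measurable (unif_sample N) (unif01 \<Otimes>\<^sub>M unif01)"
      using ij by (intro measurable_Pair)
    from AE_distrD[OF this ae] show ?thesis by simp
  qed
  then have "AE x in unif_sample N. i \<noteq> j \<longrightarrow> x i \<noteq> x j"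
    if "i \<in> {1..N}" "j \<in> {1..N}" for i j
    using that by (cases "i = j") simp_all
  then have "AE x in unif_sample N. \<forall>i\<in>{1..N}. \<forall>j\<in>{1..N}. i \<noteq> j \<longrightarrow> x i \<noteq> x j"
    by (intro AE_ball_countable' countable_finite finite_atLeastAtMost)
  then show ?thesis
    by eventually_elim (unfold inj_on_def, blast)
qed

section \<open>Counting sample points and the Chernoff bound\<close>

text \<open>Indices are counted rather than distinct values, so the count is a sum of independent
  indicators; it equals the number of distinct points in \<open>A\<close> whenever \<open>x\<close>
  is injective.\<close>

definition sample_count :: "nat \<Rightarrow> (nat \<Rightarrow> real) \<Rightarrow> real set \<Rightarrow> nat" where
  "sample_count N x A = card {i\<in>{1..N}. x i \<in> A}"

lemma sample_count_eq_sum: "real (sample_count N x A) = (\<Sum>i\<in>{1..N}. indicator A (x i))"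
  by (simp add: sample_count_def indicator_def sum.If_cases Int_def flip: of_bool_def)

lemma sample_count_measurable [measurable]:
  assumes [measurable]: "A \<in> sets borel"
  shows "(\<lambda>x. sample_count N x A) \<in> measurable (unif_sample N) (count_space UNIV)"
proof -
  note measurable_unif_sample_component [measurable]
  show ?thesis unfolding sample_count_def by measurable
qed

lemma sample_count_mono: "A \<subseteq> B \<Longrightarrow> sample_count N x A \<le> sample_count N x B"
  unfolding sample_count_def by (rule card_mono) auto

text \<open>Markov's inequality for \<open>exp (s * sample_count N x A)\<close>, whose mean
  factorises. The sign of \<open>s\<close> is free: positive gives the upper tail, negative the
  lower one.\<close>

lemma sample_count_tail:
  fixes s c :: real
  assumes [measurable]: "A \<in> sets borel"
  shows "\<P>(x in unif_sample N. s * c \<le> s * sample_count N x A)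
    \<le> exp (N * measure lborel (A \<inter> {0..1}) * (exp s - 1) - s * c)"
proof -
  interpret S: prob_space "unif_sample N" by (rule prob_space_unif_sample)
  define p where "p = measure lborel (A \<inter> {0..1})"
  have p: "measure unif01 A = p"
    by (simp add: p_def measure_uniform_measure Int_commute)
  have int: "integrable unif01 (\<lambda>y. exp (s * indicator A y))"
  proof (rule unif01.integrable_const_bound[where B = "exp \<bar>s\<bar>"])
    show "(\<lambda>y. exp (s * indicator A y)) \<in> borel_measurable unif01" by measurable
  qed (auto simp: indicator_def)
  have factor: "exp (s * real (sample_count N x A)) = (\<Prod>i\<in>{1..N}. exp (s * indicator A (x i)))" for x
    unfolding sample_count_eq_sum sum_distrib_left by (rule exp_sum) simp
  have prod_int: "integrable (unif_sample N) (\<lambda>x. \<Prod>i\<in>{1..N}. exp (s * indicator A (x i)))"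
    unfolding unif_sample_def by (rule unif01_prod.product_integrable_prod) (use int in auto)
  have "(\<integral>y. exp (s * indicator A y) \<partial>unif01) = (\<integral>y. 1 + (exp s - 1) * indicator A y \<partial>unif01)"
    by (rule Bochner_Integration.integral_cong) (auto simp: indicator_def)
  also have "\<dots> = 1 + p * (exp s - 1)"
    by (subst Bochner_Integration.integral_add)
       (auto simp: p unif01.prob_space intro!: integrable_mult_right unif01.integrable_const_bound[where B = 1])
  finally have one: "(\<integral>y. exp (s * indicator A y) \<partial>unif01) = 1 + p * (exp s - 1)" .
  have "\<P>(x in unif_sample N. s * c \<le> s * sample_count N x A)
      = \<P>(x in unif_sample N. exp (s * c) \<le> exp (s * sample_count N x A))"
    by simp
  also have "\<dots> \<le> (\<integral>x. exp (s * sample_count N x A) \<partial>unif_sample N) / exp (s * c)"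
  proof (rule integral_Markov_inequality_measure[where A = "{}"])
    show "integrable (unif_sample N) (\<lambda>x. exp (s * sample_count N x A))"
      unfolding factor by (rule prod_int)
  qed simp_all
  also have "(\<integral>x. exp (s * sample_count N x A) \<partial>unif_sample N) = (1 + p * (exp s - 1)) ^ N"
    unfolding factor unif_sample_def
    by (subst unif01_prod.product_integral_prod) (use int one in auto)
  \<comment> \<open>This is \<open>1 + y \<le> exp y\<close> raised to the power \<open>N\<close>;
    the base is nonnegative because it is the mean of an exponential.\<close>
  also have "\<dots> \<le> exp (p * (exp s - 1)) ^ N"
  proof (rule power_mono)
    have "0 \<le> (\<integral>y. exp (s * indicator A y) \<partial>unif01)" by simp
    then show "0 \<le> 1 + p * (exp s - 1)" by (simp only: one)
  qed simp
  also have "\<dots> = exp (N * p * (exp s - 1))"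
    by (simp add: exp_of_nat_mult mult.assoc)
  finally show ?thesis
    by (simp add: p_def exp_diff divide_right_mono)
qed

section \<open>Measurability of the cluster events\<close>

text \<open>The size of the image is expressed by a set \<open>J\<close> of indices with pairwise
  distinct values. This leaves a finite Boolean combination of comparisons between coordinates,
  which is measurable even where ties occur.\<close>

lemma core_point_sample_iff:
  fixes x :: "nat \<Rightarrow> 'a::metric_space"
  assumes "i \<in> {1..N}"
  shows "core_point (x ` {1..N}) \<epsilon> m (x i) \<longleftrightarrow>
    (\<exists>J\<in>Pow {1..N}. m \<le> card J \<and> (\<forall>j\<in>J. dist (x i) (x j) \<le> \<epsilon>) \<and> inj_on x J)"
proof -
  define A where "A = {j\<in>{1..N}. dist (x i) (x j) \<le> \<epsilon>}"
  have "eps_nbhd (x ` {1..N}) \<epsilon> (x i) = x ` A" by (auto simp: eps_nbhd_def A_def)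
  then have "core_point (x ` {1..N}) \<epsilon> m (x i) \<longleftrightarrow> m \<le> card (x ` A)"
    using assms by (simp add: core_point_def)
  also have "\<dots> \<longleftrightarrow> (\<exists>J\<subseteq>A. m \<le> card J \<and> inj_on x J)"
  proof
    assume "m \<le> card (x ` A)"
    moreover obtain J where "J \<subseteq> A" "inj_on x J" "x ` A = x ` J"
      using subset_image_inj[of "x ` A" x A] by auto
    ultimately show "\<exists>J\<subseteq>A. m \<le> card J \<and> inj_on x J" by (auto simp: card_image)
  next
    assume "\<exists>J\<subseteq>A. m \<le> card J \<and> inj_on x J"
    then obtain J where J: "J \<subseteq> A" "m \<le> card J" "inj_on x J" by blast
    have "finite A" unfolding A_def by (rule finite_subset[of _ "{1..N}"]) auto
    then have "card (x ` J) \<le> card (x ` A)" using J by (intro card_mono) auto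
    with J show "m \<le> card (x ` A)" by (simp add: card_image)
  qed
  also have "\<dots> \<longleftrightarrow> (\<exists>J\<in>Pow {1..N}. m \<le> card J \<and> (\<forall>j\<in>J. dist (x i) (x j) \<le> \<epsilon>) \<and> inj_on x J)"
  proof (unfold Bex_def, rule ex_cong1)
    have "J \<subseteq> A \<longleftrightarrow> J \<in> Pow {1..N} \<and> (\<forall>j\<in>J. dist (x i) (x j) \<le> \<epsilon>)" for J
      by (auto simp: A_def)
    then show "(J \<subseteq> A \<and> m \<le> card J \<and> inj_on x J) \<longleftrightarrow> (J \<in> Pow {1..N} \<and>
        m \<le> card J \<and> (\<forall>j\<in>J. dist (x i) (x j) \<le> \<epsilon>) \<and> inj_on x J)" for J
      by metis
  qed
  finally show ?thesis .
qed

lemma core_point_sample_measurable [measurable]: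
  assumes "i \<in> {1..N}"
  shows "Measurable.pred (unif_sample N) (\<lambda>x. core_point (x ` {1..N}) \<epsilon> m (x i))"
proof -
  note measurable_unif_sample_component [measurable]
  have dist_meas: "Measurable.pred (unif_sample N) (\<lambda>x. dist (x i) (x j) \<le> \<epsilon>)"
    if "j \<in> {1..N}" for j
    using that assms by measurable
  have eq_meas: "Measurable.pred (unif_sample N) (\<lambda>x. x j = x k)"
    if "j \<in> {1..N}" "k \<in> {1..N}" for j k
    unfolding pred_def using that by (intro borel_measurable_eq) measurable
  show ?thesis
    unfolding core_point_sample_iff[OF assms] inj_on_def
  proof (intro pred_intros_finite pred_intros_logic)
    fix J assume J: "J \<in> Pow {1..N}"
    show fin: "finite J" "finite J" "finite J" using J finite_subset by auto
    fix j k assume jk: "j \<in> J" "k \<in> J"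
    show "Measurable.pred (unif_sample N) (\<lambda>x. x j = x k)" using J jk by (intro eq_meas) auto
  next
    fix J j assume "J \<in> Pow {1..N}" "j \<in> J"
    then show "Measurable.pred (unif_sample N) (\<lambda>x. dist (x i) (x j) \<le> \<epsilon>)" by (intro dist_meas) auto
  qed (simp_all add: measurable_const)
qed

lemma num_clusters_sample_eq_0_iff:
  fixes x :: "nat \<Rightarrow> 'a::metric_space"
  shows
  "num_clusters (x ` {1..N}) \<epsilon> m = 0 \<longleftrightarrow>
    (\<forall>i\<in>{1..N}. \<not> core_point (x ` {1..N}) \<epsilon> m (x i))"
  unfolding num_clusters_eq_0_iff[OF finite_imageI[OF finite_atLeastAtMost]]
  by (auto simp: core_point_def)

text \<open>Core points are sample values, so each real quantifier becomes one over indices; this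
  finite form is what makes the event measurable.\<close>

lemma num_clusters_sample_eq_1_iff:
  fixes x :: "nat \<Rightarrow> real"
  shows "num_clusters (x ` {1..N}) \<epsilon> m = 1 \<longleftrightarrow>
    (\<exists>i\<in>{1..N}. core_point (x ` {1..N}) \<epsilon> m (x i)) \<and>
    (\<forall>i\<in>{1..N}. core_point (x ` {1..N}) \<epsilon> m (x i) \<longrightarrow>
      (\<forall>j\<in>{1..N}. core_point (x ` {1..N}) \<epsilon> m (x j) \<longrightarrow> x i < x j \<longrightarrow>
        (\<exists>k\<in>{1..N}. core_point (x ` {1..N}) \<epsilon> m (x k) \<and> x i < x k \<and> x k \<le> x i + \<epsilon>)))"
proof -
  define C where "C = core_point (x ` {1..N}) \<epsilon> m"
  have C: "p \<in> x ` {1..N}" if "C p" for p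
    using that by (simp add: C_def core_point_def)
  have ex: "(\<exists>p. C p \<and> Q p) \<longleftrightarrow> (\<exists>i\<in>{1..N}. C (x i) \<and> Q (x i))"
    and all: "(\<forall>p. C p \<longrightarrow> Q p) \<longleftrightarrow> (\<forall>i\<in>{1..N}. C (x i) \<longrightarrow> Q (x i))" for Q
    using C by blast+
  have "num_clusters (x ` {1..N}) \<epsilon> m = 1 \<longleftrightarrow>
    (\<exists>p. C p) \<and> (\<forall>p. C p \<longrightarrow> (\<forall>q. C q \<longrightarrow> p < q \<longrightarrow> (\<exists>r. C r \<and> p < r \<and> r \<le> p + \<epsilon>)))"
    unfolding C_def num_clusters_real_eq_1_iff[OF finite_imageI[OF finite_atLeastAtMost]] ..
  then show ?thesis
    unfolding ex all ex[of "\<lambda>_. True", unfolded simp_thms] unfolding C_def .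
qed

lemma num_clusters_sample_events:
  "Measurable.pred (unif_sample N) (\<lambda>x. num_clusters (x ` {1..N}) \<epsilon> m = 0)"
  "Measurable.pred (unif_sample N) (\<lambda>x. num_clusters (x ` {1..N}) \<epsilon> m = 1)"
proof -
  note component = measurable_unif_sample_component
  have [measurable]: "Measurable.pred (unif_sample N) (\<lambda>x. x i < x j)"
      "Measurable.pred (unif_sample N) (\<lambda>x. x j \<le> x i + \<epsilon>)"
    if "i \<in> {1..N}" "j \<in> {1..N}" for i j
    unfolding pred_def using component[OF that(1)] component[OF that(2)] by measurable
  show "Measurable.pred (unif_sample N) (\<lambda>x. num_clusters (x ` {1..N}) \<epsilon> m = 0)"
    "Measurable.pred (unif_sample N) (\<lambda>x. num_clusters (x ` {1..N}) \<epsilon> m = 1)"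
    unfolding num_clusters_sample_eq_0_iff num_clusters_sample_eq_1_iff by measurable
qed

section \<open>Criteria for one and for no cluster\<close>

text \<open>Reduces a probability bound to a deterministic implication off a bad event
  \<open>B\<close>. Ties and values outside [0,1] have probability 0, so they may be excluded as
  well.\<close>

lemma unif_sample_prob_gtI:
  assumes P: "Measurable.pred (unif_sample N) P"
    and B: "B \<in> sets (unif_sample N)" "measure (unif_sample N) B < \<delta>"
    and imp: "\<And>x. x \<notin> B \<Longrightarrow> x \<in> space (unif_sample N) \<Longrightarrow> inj_on x {1..N} \<Longrightarrow> \<forall>i\<in>{1..N}. x i \<in> {0..1} \<Longrightarrow> P x"
  shows "\<P>(x in unif_sample N. P x) > 1 - \<delta>"
proof -
  interpret S: prob_space "unif_sample N" by (rule prob_space_unif_sample)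
  have "1 - S.prob B = S.prob (space (unif_sample N) - B)"
    using S.prob_compl[OF B(1)] by simp
  also have "\<dots> \<le> \<P>(x in unif_sample N. P x)"
  proof (rule S.finite_measure_mono_AE)
    show "AE x in unif_sample N. x \<in> space (unif_sample N) - B \<longrightarrow> x \<in> {x \<in> space (unif_sample N). P x}"
      using AE_unif_sample_range AE_unif_sample_inj by eventually_elim (use imp in auto)
    show "{x \<in> space (unif_sample N). P x} \<in> sets (unif_sample N)"
      using P by simp
  qed
  finally show ?thesis using B(2) by linarith
qed

text \<open>Injectivity turns the index count into a lower bound for the number of distinct
  neighbours.\<close>

lemma core_point_sampleI:
  assumes "inj_on x {1..N}" "i \<in> {1..N}" "A \<subseteq> {x i - \<epsilon>..x i + \<epsilon>}" "m \<le> sample_count N x A"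
  shows "core_point (x ` {1..N}) \<epsilon> m (x i)"
proof -
  have "x ` {j\<in>{1..N}. x j \<in> A} \<subseteq> eps_nbhd (x ` {1..N}) \<epsilon> (x i)"
    using assms(3) by (force simp: eps_nbhd_def dist_real_def abs_le_iff)
  then have "card (x ` {j\<in>{1..N}. x j \<in> A}) \<le> card (eps_nbhd (x ` {1..N}) \<epsilon> (x i))"
    by (intro card_mono) (auto simp: eps_nbhd_def)
  moreover have "card (x ` {j\<in>{1..N}. x j \<in> A}) = sample_count N x A"
    unfolding sample_count_def by (intro card_image inj_on_subset[OF assms(1)]) auto
  ultimately show ?thesis using assms(2,4) by (simp add: core_point_def)
qed

text \<open>Ties only shrink the image, so the index count bounds each neighbourhood from
  above.\<close>

lemma no_clusters_sampleI:
  assumes "\<And>i. i \<in> {1..N} \<Longrightarrow> sample_count N x {x i - \<epsilon>..x i + \<epsilon>} < m"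
  shows "num_clusters (x ` {1..N}) \<epsilon> m = 0"
  unfolding num_clusters_sample_eq_0_iff
proof
  fix i assume i: "i \<in> {1..N}"
  have "eps_nbhd (x ` {1..N}) \<epsilon> (x i) = x ` {j\<in>{1..N}. x j \<in> {x i - \<epsilon>..x i + \<epsilon>}}"
    by (auto simp: eps_nbhd_def dist_real_def abs_le_iff)
  then have "card (eps_nbhd (x ` {1..N}) \<epsilon> (x i)) \<le> sample_count N x {x i - \<epsilon>..x i + \<epsilon>}"
    unfolding sample_count_def by (simp only:) (rule card_image_le, simp)
  with assms[OF i] show "\<not> core_point (x ` {1..N}) \<epsilon> m (x i)"
    by (simp add: core_point_def)
qed

lemma sample_count_pos_iff: "0 < sample_count N x A \<longleftrightarrow> (\<exists>i\<in>{1..N}. x i \<in> A)"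
  by (auto simp: sample_count_def card_gt_0_iff)

lemma one_cluster_interior:
  assumes inj: "inj_on x {1..N}" and range: "\<forall>i\<in>{1..N}. x i \<in> {0..1}"
    and h: "0 < h" "2 * h < \<epsilon>" and \<epsilon>: "\<epsilon> \<le> 1 / 2"
    and dense: "\<And>u. 0 \<le> u \<Longrightarrow> u + (2 * \<epsilon> - 2 * h) \<le> 1 \<Longrightarrow> m \<le> sample_count N x {u..u + (2 * \<epsilon> - 2 * h)}"
    and hit: "\<And>u. 0 \<le> u \<Longrightarrow> u + 2 * h \<le> 1 \<Longrightarrow> 0 < sample_count N x {u..u + 2 * h}"
  shows "num_clusters (x ` {1..N}) \<epsilon> m = 1"
proof -
  let ?core = "\<lambda>i. core_point (x ` {1..N}) \<epsilon> m (x i)"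
  have interior: "?core i" if i: "i \<in> {1..N}" "\<epsilon> - 2 * h \<le> x i" "x i \<le> 1 - \<epsilon> + 2 * h" for i
  proof (rule core_point_sampleI[OF inj i(1)])
    \<comment> \<open>The window is clipped at 0; the lower bound on \<open>x i\<close> keeps its
      right end below \<open>x i + \<epsilon>\<close>, and the upper bound together with
      \<open>\<epsilon> \<le> 1 / 2\<close> keeps it inside [0,1].\<close>
    let ?u = "max 0 (x i - \<epsilon>)"
    show "{?u..?u + (2 * \<epsilon> - 2 * h)} \<subseteq> {x i - \<epsilon>..x i + \<epsilon>}" using i h by auto
    show "m \<le> sample_count N x {?u..?u + (2 * \<epsilon> - 2 * h)}" using i h \<epsilon> by (intro dense) auto
  qed
  have core: "\<exists>i\<in>{1..N}. ?core i \<and> u \<le> x i \<and> x i \<le> u + 2 * h"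
    if u: "\<epsilon> - 2 * h \<le> u" "u \<le> 1 - \<epsilon>" for u
  proof -
    have "0 < sample_count N x {u..u + 2 * h}" using u h by (intro hit) auto
    then obtain i where "i \<in> {1..N}" "u \<le> x i" "x i \<le> u + 2 * h" 
      by (auto simp: sample_count_pos_iff)
    moreover from this have "?core i" using u h by (intro interior) auto
    ultimately show ?thesis by blast
  qed
  show ?thesis
    unfolding num_clusters_sample_eq_1_iff
  proof (intro conjI ballI impI)
    show "\<exists>i\<in>{1..N}. ?core i" using core[of "\<epsilon> - 2 * h"] h \<epsilon> by fastforce
    fix i j assume ij: "i \<in> {1..N}" "j \<in> {1..N}" "?core i" "?core j" "x i < x j"
    then have bounds: "0 \<le> x i" "x j \<le> 1" using range by auto
    \<comment> \<open>In case 2 a core point is found in the last stretch of length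
      \<open>2 * h\<close> before \<open>x i + \<epsilon>\<close>. In case 3 that stretch leaves the
      interior, and \<open>{1 - \<epsilon>..1 - \<epsilon> + 2 * h}\<close> replaces it; it lies
      between \<open>x i\<close> and \<open>x i + \<epsilon>\<close> by the case assumptions and
      \<open>x j \<le> 1\<close>.\<close>
    consider "x j \<le> x i + \<epsilon>" | "x i + \<epsilon> \<le> 1 - \<epsilon> + 2 * h"
      | "x i + \<epsilon> < x j" "1 - \<epsilon> + 2 * h < x i + \<epsilon>" by linarith
    then show "\<exists>k\<in>{1..N}. ?core k \<and> x i < x k \<and> x k \<le> x i + \<epsilon>"
    proof cases
      case 1
      then show ?thesis using ij by blast
    next
      case 2
      with core[of "x i + \<epsilon> - 2 * h"] bounds h show ?thesis by fastforce
    next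
      case 3
      with core[of "1 - \<epsilon>"] bounds h \<epsilon> show ?thesis by fastforce
    qed
  qed
qed

text \<open>Every point is core: after clipping at 0, a window of length 1/2 fits within \<epsilon>
  of it. A gap longer than \<epsilon> would leave room for \<open>{x i..x i + 1 / 2}\<close>, which
  holds a second point because \<open>2 \<le> m\<close>.\<close>

lemma one_cluster_wide:
  assumes inj: "inj_on x {1..N}" and range: "\<forall>i\<in>{1..N}. x i \<in> {0..1}"
    and \<epsilon>: "1 / 2 \<le> \<epsilon>" and m: "2 \<le> m"
    and dense: "\<And>u. 0 \<le> u \<Longrightarrow> u + 1 / 2 \<le> 1 \<Longrightarrow> m \<le> sample_count N x {u..u + 1 / 2}"
  shows "num_clusters (x ` {1..N}) \<epsilon> m = 1"
proof -
  let ?core = "\<lambda>i. core_point (x ` {1..N}) \<epsilon> m (x i)"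
  have core: "?core i" if i: "i \<in> {1..N}" for i
  proof (rule core_point_sampleI[OF inj i])
    let ?u = "max 0 (x i - 1 / 2)"
    have "0 \<le> x i" "x i \<le> 1" using range i by auto
    then show "{?u..?u + 1 / 2} \<subseteq> {x i - \<epsilon>..x i + \<epsilon>}" "m \<le> sample_count N x {?u..?u + 1 / 2}"
      using \<epsilon> by (auto intro!: dense)
  qed
  show ?thesis
    unfolding num_clusters_sample_eq_1_iff
  proof (intro conjI ballI impI)
    have "0 < sample_count N x {0..0 + 1 / 2}" using dense[of 0] m by simp
    then show "\<exists>i\<in>{1..N}. ?core i" using core by (auto simp only: sample_count_pos_iff)
    fix i j assume ij: "i \<in> {1..N}" "j \<in> {1..N}" "?core i" "?core j" "x i < x j"
    show "\<exists>k\<in>{1..N}. ?core k \<and> x i < x k \<and> x k \<le> x i + \<epsilon>"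
    proof (cases "x j \<le> x i + \<epsilon>")
      case True
      then show ?thesis using ij by blast
    next
      case False
      have "0 \<le> x i" "x j \<le> 1" using range ij by auto
      then have "2 \<le> card {k\<in>{1..N}. x k \<in> {x i..x i + 1 / 2}}"
        using dense[of "x i"] False \<epsilon> m unfolding sample_count_def by linarith
      then have "\<not> {k\<in>{1..N}. x k \<in> {x i..x i + 1 / 2}} \<subseteq> {i}"
        using card_mono[of "{i}" "{k\<in>{1..N}. x k \<in> {x i..x i + 1 / 2}}"] by auto
      then obtain k where k: "k \<in> {1..N}" "x i \<le> x k" "x k \<le> x i + 1 / 2" "k \<noteq> i" by auto
      then have "x k \<noteq> x i" using inj ij by (auto dest: inj_onD)
      with k \<epsilon> core show ?thesis by force
    qed
  qed
qed

text \<open>A sample point in \<open>{1 - \<epsilon>..\<epsilon>}\<close> is within \<epsilon> of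
  all of [0,1]. Its neighbourhood is the whole sample, and it serves as the intermediate hop for any
  two core points further apart than \<epsilon>.\<close>

lemma one_cluster_centre:
  assumes inj: "inj_on x {1..N}" and range: "\<forall>i\<in>{1..N}. x i \<in> {0..1}"
    and m: "m \<le> N" and c: "c \<in> {1..N}" "1 - \<epsilon> \<le> x c" "x c \<le> \<epsilon>"
  shows "num_clusters (x ` {1..N}) \<epsilon> m = 1"
proof -
  have "{i\<in>{1..N}. x i \<in> {0..1}} = {1..N}" using range by auto
  then have "sample_count N x {0..1} = N" by (simp add: sample_count_def)
  then have core: "core_point (x ` {1..N}) \<epsilon> m (x c)"
    using c m by (intro core_point_sampleI[OF inj c(1), where A = "{0..1}"]) auto
  show ?thesis
    unfolding num_clusters_sample_eq_1_iff
  proof (intro conjI ballI impI)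
    show "\<exists>i\<in>{1..N}. core_point (x ` {1..N}) \<epsilon> m (x i)" using core c by blast
    fix i j assume ij: "i \<in> {1..N}" "j \<in> {1..N}" "core_point (x ` {1..N}) \<epsilon> m (x j)" "x i < x j"
    moreover have "0 \<le> x i" "x j \<le> 1" using range ij by auto
    ultimately show "\<exists>k\<in>{1..N}. core_point (x ` {1..N}) \<epsilon> m (x k) \<and> x i < x k \<and> x k \<le> x i + \<epsilon>"
      using core c by (cases "x j \<le> x i + \<epsilon>") fastforce+
  qed
qed

section \<open>Union bound over a grid\<close>

lemma card_grid_le:
  fixes h l :: real
  assumes "0 < h" "0 \<le> l"
  shows "finite {j::nat. j * h + l \<le> 1}" "card {j::nat. j * h + l \<le> 1} \<le> 1 / h + 1"
proof -
  have sub: "{j::nat. j * h + l \<le> 1} \<subseteq> {..nat \<lfloor>1 / h\<rfloor>}"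
  proof clarify
    fix j :: nat assume "j * h + l \<le> 1"
    then have "j \<le> 1 / h" using assms by (simp add: field_simps)
    then show "j \<le> nat \<lfloor>1 / h\<rfloor>" by (simp add: le_nat_floor)
  qed
  then show "finite {j::nat. j * h + l \<le> 1}" by (rule finite_subset) simp
  have "card {j::nat. j * h + l \<le> 1} \<le> nat \<lfloor>1 / h\<rfloor> + 1"
    using card_mono[OF _ sub] by simp
  moreover have "real (nat \<lfloor>1 / h\<rfloor>) \<le> 1 / h" using assms by simp
  ultimately show "card {j::nat. j * h + l \<le> 1} \<le> 1 / h + 1" by linarith
qed

lemma grid_union_bound:
  fixes h l b :: real
  assumes "0 < h" "0 \<le> l" "0 \<le> b"
    and E: "\<And>j::nat. j * h + l \<le> 1 \<Longrightarrow> E j \<in> sets (unif_sample N)"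
      "\<And>j::nat. j * h + l \<le> 1 \<Longrightarrow> measure (unif_sample N) (E j) \<le> b"
  shows "(\<Union>j\<in>{j::nat. j * h + l \<le> 1}. E j) \<in> sets (unif_sample N)"
    "measure (unif_sample N) (\<Union>j\<in>{j::nat. j * h + l \<le> 1}. E j) \<le> (1 / h + 1) * b"
proof -
  interpret S: prob_space "unif_sample N" by (rule prob_space_unif_sample)
  let ?J = "{j::nat. j * h + l \<le> 1}"
  note J = card_grid_le[OF assms(1,2)]
  show "(\<Union>j\<in>?J. E j) \<in> sets (unif_sample N)"
    using J(1) E(1) by (intro sets.finite_UN) auto
  have "S.prob (\<Union>j\<in>?J. E j) \<le> (\<Sum>j\<in>?J. S.prob (E j))"
    using J(1) E(1) by (intro S.finite_measure_subadditive_finite) auto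
  also have "\<dots> \<le> card ?J * b"
    using E(2) sum_bounded_above[of ?J "\<lambda>j. S.prob (E j)" b] by auto
  also have "\<dots> \<le> (1 / h + 1) * b"
    by (intro mult_right_mono J(2) assms(3))
  finally show "S.prob (\<Union>j\<in>?J. E j) \<le> (1 / h + 1) * b" .
qed

section \<open>Concentration on windows\<close>

text \<open>A window of length \<open>l + h\<close> contains one of length \<open>l\<close> that
  starts at a multiple of \<open>h\<close>. At most \<open>1 / h + 1\<close> grid windows thus
  control all real \<open>u\<close> at once.\<close>

lemma lower_window_event:
  fixes h l s c b :: real
  assumes "0 < h" "0 \<le> l" "0 < s" and b: "b \<le> N * l * (1 - exp (- s)) - s * c"
  obtains B where "B \<in> sets (unif_sample N)" "measure (unif_sample N) B \<le> (1 / h + 1) * exp (- b)"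
    "\<And>x u. x \<in> space (unif_sample N) \<Longrightarrow> x \<notin> B \<Longrightarrow> 0 \<le> u \<Longrightarrow> u + l + h \<le> 1 \<Longrightarrow>
      c < sample_count N x {u..u + l + h}"
proof -
  define E where "E j = {x \<in> space (unif_sample N). sample_count N x {j * h..j * h + l} \<le> c}" for j :: nat
  let ?B = "\<Union>j\<in>{j::nat. j * h + l \<le> 1}. E j"
  have E: "E j \<in> sets (unif_sample N)" for j
    unfolding E_def by measurable
  have "measure (unif_sample N) (E j) \<le> exp (- b)" if j: "j * h + l \<le> 1" for j :: nat
  proof -
    have "0 \<le> j * h" using assms by simp
    with j have "{j * h..j * h + l} \<inter> {0..1} = {j * h..j * h + l}" by auto
    then have p: "measure lborel ({j * h..j * h + l} \<inter> {0..1}) = l" using assms by simp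
    have "measure (unif_sample N) (E j)
        = \<P>(x in unif_sample N. - s * c \<le> - s * sample_count N x {j * h..j * h + l})"
      unfolding E_def using assms by simp
    also have "\<dots> \<le> exp (N * l * (exp (- s) - 1) - - s * c)"
      using sample_count_tail[of "{j * h..j * h + l}" N "- s" c] by (simp only: p) simp
    also have "\<dots> \<le> exp (- b)" using b by (simp add: algebra_simps)
    finally show ?thesis .
  qed
  from grid_union_bound[OF assms(1,2) _ E this] have B: "?B \<in> sets (unif_sample N)"
    "measure (unif_sample N) ?B \<le> (1 / h + 1) * exp (- b)" by auto
  have "c < sample_count N x {u..u + l + h}"
    if x: "x \<in> space (unif_sample N)" "x \<notin> ?B" and u: "0 \<le> u" "u + l + h \<le> 1" for x u
  proof -
    \<comment> \<open>Rounding up moves the left end into the window, at a cost of at most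
      \<open>h\<close> on the right.\<close>
    define j where "j = nat \<lceil>u / h\<rceil>"
    have "real j = of_int \<lceil>u / h\<rceil>" unfolding j_def using u assms by simp
    then have "u / h \<le> j" "j \<le> u / h + 1" by linarith+
    then have j: "u \<le> j * h" "j * h \<le> u + h" using assms by (auto simp: field_simps)
    then have "j * h + l \<le> 1" using u by linarith
    then have "x \<notin> E j" using x(2) by blast
    then have "c < sample_count N x {j * h..j * h + l}"
      using x(1) by (simp add: E_def)
    also have "\<dots> \<le> sample_count N x {u..u + l + h}"
      using j by (intro of_nat_mono sample_count_mono) auto
    finally show ?thesis by simp
  qed
  from that[OF B this] show thesis .
qed

text \<open>Dual to the lower bound: \<open>W j\<close> covers the neighbourhoods of all centres in
  the \<open>j\<close>-th grid cell, at the price of an extra length \<open>h\<close>. Where it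
  sticks out of [0,1], its mean count is only smaller.\<close>

lemma upper_window_event:
  fixes h \<epsilon> s c b :: real
  assumes "0 < h" "0 \<le> \<epsilon>" "0 < s" and b: "b \<le> s * c - N * (2 * \<epsilon> + h) * (exp s - 1)"
  obtains B where "B \<in> sets (unif_sample N)" "measure (unif_sample N) B \<le> (1 / h + 1) * exp (- b)"
    "\<And>x u. x \<in> space (unif_sample N) \<Longrightarrow> x \<notin> B \<Longrightarrow> 0 \<le> u \<Longrightarrow> u \<le> 1 \<Longrightarrow>
      sample_count N x {u - \<epsilon>..u + \<epsilon>} < c"
proof -
  define W where "W j = {j * h - \<epsilon>..j * h + h + \<epsilon>}" for j :: nat
  define E where "E j = {x \<in> space (unif_sample N). c \<le> sample_count N x (W j)}" for j :: nat
  \<comment> \<open>The summand 0 matches \<open>grid_union_bound\<close> with \<open>l = 0\<close>: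
    all grid points in [0,1] are needed, as they locate the centres.\<close>
  let ?B = "\<Union>j\<in>{j::nat. j * h + 0 \<le> 1}. E j"
  have [measurable]: "W j \<in> sets borel" for j unfolding W_def by simp
  have E: "E j \<in> sets (unif_sample N)" for j
    unfolding E_def by measurable
  have "measure (unif_sample N) (E j) \<le> exp (- b)" for j :: nat
  proof -
    have "measure lborel (W j \<inter> {0..1}) \<le> measure lborel (W j)"
      by (rule measure_mono_fmeasurable) (auto simp: W_def fmeasurable_def emeasure_lborel_Icc_eq)
    then have p: "measure lborel (W j \<inter> {0..1}) \<le> 2 * \<epsilon> + h" using assms by (simp add: W_def)
    have "measure (unif_sample N) (E j) = \<P>(x in unif_sample N. s * c \<le> s * sample_count N x (W j))"
      unfolding E_def using assms by simp
    also have "\<dots> \<le> exp (N * measure lborel (W j \<inter> {0..1}) * (exp s - 1) - s * c)"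
      by (rule sample_count_tail) simp
    also have "\<dots> \<le> exp (N * (2 * \<epsilon> + h) * (exp s - 1) - s * c)"
      using p assms by (auto intro!: mult_right_mono mult_left_mono)
    also have "\<dots> \<le> exp (- b)" using b by simp
    finally show ?thesis .
  qed
  from grid_union_bound[OF assms(1) order_refl _ E this] have B: "?B \<in> sets (unif_sample N)"
    "measure (unif_sample N) ?B \<le> (1 / h + 1) * exp (- b)" by auto
  have "sample_count N x {u - \<epsilon>..u + \<epsilon>} < c"
    if x: "x \<in> space (unif_sample N)" "x \<notin> ?B" and u: "0 \<le> u" "u \<le> 1" for x u
  proof -
    define j where "j = nat \<lfloor>u / h\<rfloor>"
    have "real j = of_int \<lfloor>u / h\<rfloor>" unfolding j_def using u assms by simp
    then have "j \<le> u / h" "u / h \<le> j + 1" by linarith+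
    then have j: "j * h \<le> u" "u \<le> j * h + h" using assms by (auto simp: field_simps)
    then have "j * h + 0 \<le> 1" using u by linarith
    then have "x \<notin> E j" using x(2) by blast
    then have "sample_count N x (W j) < c"
      using x(1) by (simp add: E_def)
    moreover have "sample_count N x {u - \<epsilon>..u + \<epsilon>} \<le> sample_count N x (W j)"
      using j by (intro sample_count_mono) (auto simp: W_def)
    ultimately show ?thesis by linarith
  qed
  from that[OF B this] show thesis .
qed

section \<open>Elementary estimates for the exponents\<close>

text \<open>\<open>exp q\<close> is at least \<open>1 + q + q\<^sup>2 / 2\<close>, and the product
  of this polynomial with its value at \<open>- q\<close> is at least 1. Used for the lower
  tail.\<close>

lemma one_minus_exp_minus_ge:
  fixes q :: real
  assumes "0 \<le> q"
  shows "q - q\<^sup>2 / 2 \<le> 1 - exp (- q)"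
proof -
  have "(1 + q + q\<^sup>2 / 2) * (1 - q + q\<^sup>2 / 2) = 1 + (q\<^sup>2)\<^sup>2 / 4"
    by (simp add: algebra_simps power2_eq_square)
  then have "1 \<le> (1 + q + q\<^sup>2 / 2) * (1 - q + q\<^sup>2 / 2)" by simp
  moreover have "0 \<le> 1 - q + q\<^sup>2 / 2"
    using zero_le_power2[of "1 - q"] unfolding power2_diff by simp
  ultimately have "1 \<le> exp q * (1 - q + q\<^sup>2 / 2)"
    using exp_lower_Taylor_quadratic[OF assms] by (meson mult_right_mono order_trans)
  then show ?thesis by (simp add: exp_minus field_simps)
qed

text \<open>Since \<open>exp (- q)\<close> is at least \<open>(1 - q / 2)\<^sup>2\<close>, a
  polynomial inequality remains. Used for the upper tail, where the mean of a window is at most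
  \<open>m * (1 - q)\<close>.\<close>

lemma one_minus_mult_exp_le:
  fixes q :: real
  assumes "0 \<le> q" "q \<le> 1"
  shows "(1 - q) * exp q \<le> 1 - q\<^sup>2 / 4"
proof -
  have "(1 - q / 2)\<^sup>2 \<le> (exp (- (q / 2)))\<^sup>2"
    using exp_ge_add_one_self[of "- (q / 2)"] assms by (intro power_mono) auto
  also have "\<dots> = exp (- q)" by (simp flip: exp_double)
  finally have e: "1 - q + q\<^sup>2 / 4 \<le> exp (- q)" by (simp add: power2_diff power_divide)
  have sq: "q\<^sup>2 \<le> q" using assms by (simp add: power2_eq_square mult_left_le)
  have "(1 - q\<^sup>2 / 4) * (1 - q + q\<^sup>2 / 4) - (1 - q) = q\<^sup>2 / 4 * (q - q\<^sup>2 / 4)"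
    by (simp add: field_simps power2_eq_square)
  moreover have "0 \<le> q\<^sup>2 / 4 * (q - q\<^sup>2 / 4)"
    using sq assms by (intro mult_nonneg_nonneg) auto
  ultimately have "1 - q \<le> (1 - q\<^sup>2 / 4) * (1 - q + q\<^sup>2 / 4)" by linarith
  also have "\<dots> \<le> (1 - q\<^sup>2 / 4) * exp (- q)"
    using e sq assms by (intro mult_left_mono) auto
  finally show ?thesis by (simp add: exp_minus field_simps)
qed

text \<open>The sample bound unfolds to \<open>m * q\<^sup>2 / 40 > k * ln (1 / y)\<close>. The rate
  \<open>m * q\<^sup>2 / 40\<close> is a common lower bound for the Chernoff exponents of all window
  events.\<close>

lemma exp_less_power_of_sample_bound:
  fixes q \<delta> \<epsilon> \<rho> :: real
  assumes "0 < q" "0 < \<rho>" "0 < \<delta> * \<epsilon> * q"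
    and N: "N > sample_bound (40 * k) \<rho> q \<delta> \<epsilon>" and m: "m = \<rho> * N"
  shows "exp (- (m * q\<^sup>2 / 40)) < (\<delta> * \<epsilon> * q) ^ k"
proof -
  define y where "y = \<delta> * \<epsilon> * q"
  have y: "0 < y" using assms(3) by (simp add: y_def)
  have "40 * k * (ln (1 / y) / (\<rho> * q\<^sup>2)) < N"
    using N by (simp add: sample_bound_def y_def)
  then have "40 * k * ln (1 / y) < m * q\<^sup>2"
    using assms(1,2) m by (simp add: field_simps)
  moreover have "ln (1 / y) = - ln y"
    using ln_div[of 1 y] y by simp
  ultimately have "- (m * q\<^sup>2 / 40) < k * ln y" by simp
  then have "exp (- (m * q\<^sup>2 / 40)) < exp (k * ln y)" by simp
  also have "\<dots> = y ^ k" using y by (simp add: exp_of_nat_mult)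
  finally show ?thesis by (simp add: y_def)
qed

section \<open>The threshold\<close>

lemma unif_sample_component_prob:
  assumes "i \<in> {1..N}" and A: "A \<in> sets borel"
  shows "\<P>(x in unif_sample N. x i \<in> A) = measure lborel (A \<inter> {0..1})"
proof -
  have "(\<lambda>x. x i) \<in> measurable (unif_sample N) unif01"
    using measurable_unif_sample_component[OF assms(1)] by simp
  then have "measure unif01 A = measure (unif_sample N) ((\<lambda>x. x i) -` A \<inter> space (unif_sample N))"
    using measure_distr[of "\<lambda>x. x i" "unif_sample N" unif01 A] A
    by (simp add: distr_unif_sample_component[OF assms(1)])
  also have "(\<lambda>x. x i) -` A \<inter> space (unif_sample N) = {x \<in> space (unif_sample N). x i \<in> A}" by auto
  finally show ?thesis using A by (simp add: measure_uniform_measure Int_commute)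
qed

text \<open>Here 320 = 40 * 8. Of the eight powers of \<open>\<delta> * \<epsilon> * q\<close>, one
  turns the grid factor \<open>1 / (\<epsilon> * q)\<close> into \<delta>, and seven absorb the
  constant \<open>K\<close>.\<close>

lemma failure_bound:
  fixes q \<delta> \<epsilon> \<rho> K p :: real
  assumes "0 < q" "0 < \<rho>" "0 < \<delta>" "0 < \<epsilon>" "0 < K"
    and "N > sample_bound 320 \<rho> q \<delta> \<epsilon>" and "m = \<rho> * N"
    and p: "p \<le> K / (\<epsilon> * q) * exp (- (m * q\<^sup>2 / 40))" and K: "K * (\<delta> * \<epsilon> * q) ^ 7 \<le> 1"
  shows "p < \<delta>"
proof -
  have "exp (- (m * q\<^sup>2 / 40)) < (\<delta> * \<epsilon> * q) ^ 8"
    by (rule exp_less_power_of_sample_bound[where \<rho> = \<rho> and N = N]) (use assms in auto)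
  with p assms have "p < K / (\<epsilon> * q) * (\<delta> * \<epsilon> * q) ^ 8"
    by (meson mult_pos_pos divide_pos_pos mult_strict_left_mono order_le_less_trans)
  also have "\<dots> = (K * (\<delta> * \<epsilon> * q) ^ 7) * \<delta>"
    using assms by (simp add: field_simps eval_nat_numeral)
  also have "\<dots> \<le> \<delta>" using K assms by (simp add: mult_left_le_one_le)
  finally show ?thesis .
qed

section \<open>Probability bounds by the size of \<epsilon>\<close>

lemma no_clusters_probability:
  fixes q \<delta> \<epsilon> \<rho> :: real
  assumes q: "0 < q" "q < 1" and \<rho>: "0 < \<rho>" "\<rho> < 1 / 4" and \<delta>: "0 < \<delta>" "\<delta> \<le> 1"
    and \<epsilon>: "0 < \<epsilon>" "2 * \<epsilon> < \<rho> * (1 - q)\<^sup>2"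
    and N: "real N > sample_bound 320 \<rho> q \<delta> \<epsilon>" and m: "real m = \<rho> * N"
  shows "\<P>(x in unif_sample N. num_clusters (x ` {1..N}) \<epsilon> m = 0) > 1 - \<delta>"
proof -
  have "(1 - q)\<^sup>2 \<le> 1" using q by (simp add: power_le_one)
  then have "\<rho> * (1 - q)\<^sup>2 \<le> \<rho>" using \<rho> by (simp add: mult_left_le)
  then have \<epsilon>8: "\<epsilon> \<le> 1 / 8" using \<epsilon> \<rho> by linarith
  have \<epsilon>q: "0 < \<epsilon> * q" "\<epsilon> * q \<le> 1 / 8"
    using q \<epsilon> \<epsilon>8 mult_mono[of \<epsilon> "1/8" q 1] by auto
  \<comment> \<open>With grid step \<open>2 * \<epsilon> * q\<close> the enlarged neighbourhood has
    length \<open>2 * \<epsilon> * (1 + q)\<close>. One of the two factors \<open>1 - q\<close> in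
    the hypothesis pays for \<open>1 + q\<close>; the other is the margin for the Chernoff bound
    with \<open>s = q\<close>.\<close>
  have mean: "N * (2 * \<epsilon> + 2 * \<epsilon> * q) \<le> m * (1 - q)"
  proof -
    have "N * (2 * \<epsilon> + 2 * \<epsilon> * q) = N * (2 * \<epsilon>) * (1 + q)" by (simp add: algebra_simps)
    also have "\<dots> \<le> N * (\<rho> * (1 - q)\<^sup>2) * (1 + q)"
      using \<epsilon> q by (intro mult_right_mono mult_left_mono) auto
    also have "\<dots> = m * (1 - q) * (1 - q\<^sup>2)"
      unfolding m by (simp add: algebra_simps power2_eq_square)
    also have "\<dots> \<le> m * (1 - q)"
      using q by (intro mult_left_le) auto
    finally show ?thesis .
  qed
  have "N * (2 * \<epsilon> + 2 * \<epsilon> * q) * (exp q - 1) \<le> m * (1 - q) * (exp q - 1)"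
    using mean q by (intro mult_right_mono) auto
  also have "\<dots> = m * ((1 - q) * exp q - 1 + q)" by (simp add: algebra_simps)
  also have "\<dots> \<le> m * (q - q\<^sup>2 / 4)"
    using one_minus_mult_exp_le[of q] q by (intro mult_left_mono) auto
  finally have "m * q\<^sup>2 / 4 \<le> q * m - N * (2 * \<epsilon> + 2 * \<epsilon> * q) * (exp q - 1)"
    by (simp add: algebra_simps)
  moreover have "m * q\<^sup>2 / 40 \<le> m * q\<^sup>2 / 4" by simp
  ultimately have b: "m * q\<^sup>2 / 40 \<le> q * m - N * (2 * \<epsilon> + 2 * \<epsilon> * q) * (exp q - 1)" by linarith
  have pos: "0 < 2 * \<epsilon> * q" "0 \<le> \<epsilon>" using \<epsilon> q by auto
  obtain B where B: "B \<in> sets (unif_sample N)"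
    "measure (unif_sample N) B \<le> (1 / (2 * \<epsilon> * q) + 1) * exp (- (m * q\<^sup>2 / 40))"
    and few: "\<And>x u. x \<in> space (unif_sample N) \<Longrightarrow> x \<notin> B \<Longrightarrow> 0 \<le> u \<Longrightarrow> u \<le> 1 \<Longrightarrow>
      sample_count N x {u - \<epsilon>..u + \<epsilon>} < real m"
    using upper_window_event[OF pos q(1) b] by blast
  have "1 / (2 * \<epsilon> * q) + 1 \<le> 2 / (\<epsilon> * q)"
    using \<epsilon>q \<epsilon> q by (simp add: field_simps)
  then have "measure (unif_sample N) B \<le> 2 / (\<epsilon> * q) * exp (- (m * q\<^sup>2 / 40))"
    using B(2) by (meson exp_ge_zero mult_right_mono order_trans)
  moreover have "2 * (\<delta> * \<epsilon> * q) ^ 7 \<le> 1"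
  proof -
    have "\<delta> * (\<epsilon> * q) \<le> 1 * (1 / 8)" using \<delta> \<epsilon>q by (intro mult_mono) auto
    then have "(\<delta> * \<epsilon> * q) ^ 7 \<le> (1 / 8) ^ 7"
      using \<delta> \<epsilon> q by (intro power_mono) (auto simp: mult.assoc)
    also have "\<dots> \<le> 1 / (2::real)" by (simp add: eval_nat_numeral)
    finally show ?thesis by simp
  qed
  ultimately have "measure (unif_sample N) B < \<delta>"
    by (intro failure_bound[OF q(1) \<rho>(1) \<delta>(1) \<epsilon>(1) _ N m]) auto
  then show ?thesis
  proof (rule unif_sample_prob_gtI[OF num_clusters_sample_events(1) B(1)])
    fix x assume x: "x \<notin> B" "x \<in> space (unif_sample N)" and range: "\<forall>i\<in>{1..N}. x i \<in> {0..1}"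
    show "num_clusters (x ` {1..N}) \<epsilon> m = 0"
    proof (rule no_clusters_sampleI)
      fix i assume "i \<in> {1..N}"
      then have "x i \<in> {0..1}" using range by blast
      then show "sample_count N x {x i - \<epsilon>..x i + \<epsilon>} < m"
        using few[of x "x i"] x by simp
    qed
  qed
qed

lemma one_cluster_probability_small:
  fixes q \<delta> \<epsilon> \<rho> :: real
  assumes q: "0 < q" "q < 1" and \<rho>: "0 < \<rho>" and \<delta>: "0 < \<delta>" "\<delta> \<le> 1"
    and \<epsilon>: "\<epsilon> \<le> 1 / 2" "\<rho> < 2 * \<epsilon> * (1 - q)\<^sup>2"
    and N: "real N > sample_bound 320 \<rho> q \<delta> \<epsilon>" and m: "real m = \<rho> * N"
  shows "\<P>(x in unif_sample N. num_clusters (x ` {1..N}) \<epsilon> m = 1) > 1 - \<delta>"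
proof -
  interpret S: prob_space "unif_sample N" by (rule prob_space_unif_sample)
  have sq1: "(1 - q)\<^sup>2 \<le> 1" using q by (simp add: power_le_one)
  have \<epsilon>0: "0 < \<epsilon>"
    using \<epsilon>(2) \<rho> zero_le_power2[of "1 - q"] by (smt (verit) mult_nonneg_nonneg mult_nonpos_nonneg)
  have \<rho>\<epsilon>: "\<rho> \<le> 2 * \<epsilon>"
    using \<epsilon>(2) mult_left_mono[OF sq1, of "2 * \<epsilon>"] \<epsilon>0 by linarith
  have \<epsilon>q: "0 < \<epsilon> * q" "\<epsilon> * q \<le> 1 / 2" "\<epsilon> * q < \<epsilon>"
    using q \<epsilon> \<epsilon>0 mult_mono[of \<epsilon> "1/2" q 1] by auto
  \<comment> \<open>This choice gives
    \<open>2 * \<epsilon> - 4 * h = 2 * \<epsilon> * (1 - q)\<close>. The windows to be filled have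
    length \<open>2 * \<epsilon> - 2 * h\<close>; the grid takes one \<open>h\<close>, and the
    remaining \<open>2 * \<epsilon> - 3 * h\<close> keeps a margin of one factor
    \<open>1 - q\<close>.\<close>
  define h where "h = \<epsilon> * q / 2"
  have h: "0 < h" "2 * h < \<epsilon>" using \<epsilon>q by (auto simp: h_def)
  have q2: "q\<^sup>2 \<le> q" using q by (simp add: power2_eq_square mult_left_le)
  define X where "X = N * (2 * \<epsilon> - 3 * h)"
  have "real m \<le> N * (2 * \<epsilon> * (1 - q)\<^sup>2)"
    unfolding m mult.commute[of \<rho>] using \<epsilon>(2) by (intro mult_left_mono) auto
  also have "\<dots> = N * (2 * \<epsilon> - 4 * h) * (1 - q)"
    by (simp add: h_def algebra_simps power2_eq_square)
  also have "\<dots> \<le> X * (1 - q)"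
    unfolding X_def using h q by (intro mult_right_mono mult_left_mono) auto
  finally have X: "real m \<le> X * (1 - q)" .
  \<comment> \<open>Both sides are multiplied by \<open>1 - q\<close>, so that the bound
    \<open>X\<close> applies; the factor is cancelled at the end.\<close>
  have "m * q\<^sup>2 / 2 \<le> X * (q - q\<^sup>2 / 2) - q * m"
  proof -
    have "(1 - q) * (m * q\<^sup>2 / 2) \<le> m * q\<^sup>2 / 2" 
      using q by (intro mult_left_le_one_le) auto
    also have "\<dots> = m * (q - q\<^sup>2 / 2) - (1 - q) * (q * m)" by (simp add: field_simps power2_eq_square)
    also have "\<dots> \<le> X * (1 - q) * (q - q\<^sup>2 / 2) - (1 - q) * (q * m)"
      using X q q2 by (intro diff_right_mono mult_right_mono) auto
    also have "\<dots> = (1 - q) * (X * (q - q\<^sup>2 / 2) - q * m)" by (simp add: algebra_simps)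
    finally show ?thesis using q by simp
  qed
  also have "\<dots> \<le> X * (1 - exp (- q)) - q * m"
  proof -
    have "0 \<le> X" unfolding X_def using h by simp
    then show ?thesis using one_minus_exp_minus_ge[of q] q by (intro diff_right_mono mult_left_mono) auto
  qed
  finally have "m * q\<^sup>2 / 40 \<le> N * (2 * \<epsilon> - 3 * h) * (1 - exp (- q)) - q * m"
    unfolding X_def by (rule order_trans[rotated]) simp
  moreover have "0 \<le> 2 * \<epsilon> - 3 * h" using h by simp
  ultimately obtain B where B: "B \<in> sets (unif_sample N)"
    "measure (unif_sample N) B \<le> (1 / h + 1) * exp (- (m * q\<^sup>2 / 40))"
    and dense: "\<And>x u. x \<in> space (unif_sample N) \<Longrightarrow> x \<notin> B \<Longrightarrow> 0 \<le> u \<Longrightarrow> u + (2 * \<epsilon> - 3 * h) + h \<le> 1 \<Longrightarrow>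
      real m < sample_count N x {u..u + (2 * \<epsilon> - 3 * h) + h}"
    using lower_window_event[OF h(1) _ q(1)] by blast
  \<comment> \<open>Second event: windows of length \<open>2 * h\<close> are not empty, from the
    lower tail with \<open>l = h\<close>, \<open>c = 0\<close> and \<open>s = 1\<close>. Since
    \<open>\<rho> \<le> 2 * \<epsilon>\<close>, the mean \<open>N * h\<close> is at least
    \<open>m * q / 4\<close>.\<close>
  have "m * q\<^sup>2 \<le> m * q" "0 \<le> m * q" using q q2 by (auto intro!: mult_left_mono)
  then have "m * q\<^sup>2 / 40 \<le> m * q / 8" by linarith
  also have "\<dots> \<le> N * (2 * \<epsilon>) * q / 8"
    unfolding m mult.commute[of \<rho>] using \<rho>\<epsilon> q by (intro divide_right_mono mult_right_mono mult_left_mono) auto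
  also have "\<dots> = N * h * (1 / 2)" by (simp add: h_def)
  also have "\<dots> \<le> N * h * (1 - exp (- 1))"
    using one_minus_exp_minus_ge[of 1] h by (intro mult_left_mono) auto
  finally have "m * q\<^sup>2 / 40 \<le> N * h * (1 - exp (- 1)) - 1 * 0" by simp
  then obtain B' where B': "B' \<in> sets (unif_sample N)"
    "measure (unif_sample N) B' \<le> (1 / h + 1) * exp (- (m * q\<^sup>2 / 40))"
    and hit: "\<And>x u. x \<in> space (unif_sample N) \<Longrightarrow> x \<notin> B' \<Longrightarrow> 0 \<le> u \<Longrightarrow> u + h + h \<le> 1 \<Longrightarrow>
      0 < real (sample_count N x {u..u + h + h})"
    using lower_window_event[OF h(1) less_imp_le[OF h(1)], of 1] by (metis zero_less_one)
  have "S.prob (B \<union> B') \<le> (2 * (1 / h + 1)) * exp (- (m * q\<^sup>2 / 40))"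
    using B B' measure_Un_le[OF B(1) B'(1)] by (simp add: algebra_simps)
  \<comment> \<open>Each event contributes \<open>2 / (\<epsilon> * q) + 1\<close>, and
    \<open>\<epsilon> * q \<le> 1 / 2\<close> absorbs the additive 2.\<close>
  also have "\<dots> \<le> 5 / (\<epsilon> * q) * exp (- (m * q\<^sup>2 / 40))"
    using \<epsilon>q q \<epsilon>0 by (intro mult_right_mono) (auto simp: h_def field_simps)
  finally have "S.prob (B \<union> B') \<le> 5 / (\<epsilon> * q) * exp (- (m * q\<^sup>2 / 40))" .
  moreover have "5 * (\<delta> * \<epsilon> * q) ^ 7 \<le> 1"
  proof -
    have "\<delta> * (\<epsilon> * q) \<le> 1 * (1 / 2)" using \<delta> \<epsilon>q by (intro mult_mono) auto
    then have "(\<delta> * \<epsilon> * q) ^ 7 \<le> (1 / 2) ^ 7"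
      using \<delta> \<epsilon>0 q by (intro power_mono) (auto simp: mult.assoc)
    also have "\<dots> \<le> 1 / (5::real)" by (simp add: eval_nat_numeral)
    finally show ?thesis by simp
  qed
  ultimately have "S.prob (B \<union> B') < \<delta>"
    by (intro failure_bound[OF q(1) \<rho>(1) \<delta>(1) \<epsilon>0 _ N m]) auto
  then show ?thesis
  proof (rule unif_sample_prob_gtI[OF num_clusters_sample_events(2) sets.Un[OF B(1) B'(1)]])
    fix x assume x: "x \<notin> B \<union> B'" "x \<in> space (unif_sample N)"
      and inj: "inj_on x {1..N}" and range: "\<forall>i\<in>{1..N}. x i \<in> {0..1}"
    show "num_clusters (x ` {1..N}) \<epsilon> m = 1"
    proof (rule one_cluster_interior[OF inj range h \<epsilon>(1)])
      fix u :: real assume "0 \<le> u"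
      then show "u + (2 * \<epsilon> - 2 * h) \<le> 1 \<Longrightarrow> m \<le> sample_count N x {u..u + (2 * \<epsilon> - 2 * h)}"
        using dense[of x u] x by (simp add: algebra_simps)
      show "u + 2 * h \<le> 1 \<Longrightarrow> 0 < sample_count N x {u..u + 2 * h}"
        using hit[of x u] x \<open>0 \<le> u\<close> by (simp add: algebra_simps)
    qed
  qed
qed

text \<open>The windows have the fixed length 1/2, split into 2/5 and a grid step 1/10. As
  \<open>\<rho> < 1 / 4\<close>, the mean \<open>2 * N / 5\<close> clearly exceeds \<open>m\<close>;
  the grid factor 11 is affordable because \<open>11 * (2 / 3) ^ 7 \<le> 1\<close>.\<close>

lemma one_cluster_probability_wide:
  fixes q \<delta> \<epsilon> \<rho> :: real
  assumes q: "0 < q" "q < 1" and \<rho>: "0 < \<rho>" "\<rho> < 1 / 4" and \<delta>: "0 < \<delta>"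
    and \<epsilon>: "1 / 2 \<le> \<epsilon>" "\<epsilon> < 1" and y: "\<delta> * \<epsilon> * q \<le> 2 / 3"
    and N: "real N > sample_bound 320 \<rho> q \<delta> \<epsilon>" and m: "real m = \<rho> * N" "2 \<le> m"
  shows "\<P>(x in unif_sample N. num_clusters (x ` {1..N}) \<epsilon> m = 1) > 1 - \<delta>"
proof -
  have "real m \<le> 1 / 4 * N"
    unfolding m using \<rho> by (intro mult_right_mono) auto
  then have mN: "4 * real m \<le> N" by simp
  have "7 / 32 \<le> 1 - exp (- (1 / 4 :: real))"
    using one_minus_exp_minus_ge[of "1/4"] by (simp add: power2_eq_square)
  then have "N * (2 / 5) * (7 / 32) \<le> N * (2 / 5) * (1 - exp (- (1 / 4 :: real)))"
    by (intro mult_left_mono) auto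
  moreover have "m / 40 \<le> N * (2 / 5) * (7 / 32) - 1 / 4 * m" using mN by simp
  ultimately have b: "m / 40 \<le> N * (2 / 5) * (1 - exp (- (1 / 4))) - 1 / 4 * m" by linarith
  obtain B where B: "B \<in> sets (unif_sample N)"
    "measure (unif_sample N) B \<le> (1 / (1 / 10) + 1) * exp (- (m / 40))"
    and dense: "\<And>x u. x \<in> space (unif_sample N) \<Longrightarrow> x \<notin> B \<Longrightarrow> 0 \<le> u \<Longrightarrow> u + 2 / 5 + 1 / 10 \<le> 1 \<Longrightarrow>
      real m < sample_count N x {u..u + 2 / 5 + 1 / 10}"
    using lower_window_event[OF _ _ _ b, of "1/10"] by (metis divide_pos_pos less_imp_le zero_less_numeral zero_less_one)
  have "q\<^sup>2 \<le> 1" using q by (simp add: power_le_one)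
  then have "m * q\<^sup>2 / 40 \<le> m / 40" by (simp add: mult_left_le)
  moreover have "11 \<le> 11 / (\<epsilon> * q)"
    using q \<epsilon> mult_mono[of \<epsilon> 1 q 1] by (simp add: field_simps)
  moreover have "0 \<le> \<epsilon> * q" using q \<epsilon> by simp
  ultimately have "11 * exp (- (m / 40)) \<le> 11 / (\<epsilon> * q) * exp (- (m * q\<^sup>2 / 40))"
    by (intro mult_mono) auto
  with B(2) have "measure (unif_sample N) B \<le> 11 / (\<epsilon> * q) * exp (- (m * q\<^sup>2 / 40))" by simp
  moreover have "11 * (\<delta> * \<epsilon> * q) ^ 7 \<le> 1"
  proof -
    have "(\<delta> * \<epsilon> * q) ^ 7 \<le> (2 / 3) ^ 7"
      using \<delta> \<epsilon> q y by (intro power_mono) auto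
    also have "\<dots> \<le> 1 / (11::real)" by (simp add: eval_nat_numeral)
    finally show ?thesis by simp
  qed
  ultimately have "measure (unif_sample N) B < \<delta>"
    using \<epsilon> by (intro failure_bound[OF q(1) \<rho>(1) \<delta>(1) _ _ N m(1)]) auto
  then show ?thesis
  proof (rule unif_sample_prob_gtI[OF num_clusters_sample_events(2) B(1)])
    fix x assume x: "x \<notin> B" "x \<in> space (unif_sample N)"
      and inj: "inj_on x {1..N}" and range: "\<forall>i\<in>{1..N}. x i \<in> {0..1}"
    show "num_clusters (x ` {1..N}) \<epsilon> m = 1"
    proof (rule one_cluster_wide[OF inj range \<epsilon>(1) m(2)])
      fix u :: real assume "0 \<le> u" "u + 1 / 2 \<le> 1"
      then show "m \<le> sample_count N x {u..u + 1 / 2}"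
        using dense[of x u] x by (simp add: add.assoc)
    qed
  qed
qed

text \<open>\<open>x 1\<close> falls into \<open>{1 - \<epsilon>..\<epsilon>}\<close> with
  probability \<open>2 * \<epsilon> - 1\<close>, which is above 1/3, while
  \<open>1 - \<delta>\<close> is below 1/3.\<close>

lemma one_cluster_probability_centre:
  fixes \<delta> \<epsilon> :: real
  assumes \<delta>: "2 / 3 < \<delta>" and \<epsilon>: "2 / 3 < \<epsilon>" "\<epsilon> < 1" and m: "m \<le> N" "0 < N"
  shows "\<P>(x in unif_sample N. num_clusters (x ` {1..N}) \<epsilon> m = 1) > 1 - \<delta>"
proof -
  interpret S: prob_space "unif_sample N" by (rule prob_space_unif_sample)
  have one: "1 \<in> {1..N}" using m by simp
  let ?A = "{x \<in> space (unif_sample N). x 1 \<in> {1 - \<epsilon>..\<epsilon>}}"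
  have "?A \<in> sets (unif_sample N)"
    using measurable_unif_sample_component[OF one] by measurable
  moreover have "S.prob ?A = \<epsilon> - (1 - \<epsilon>)"
  proof -
    have "{1 - \<epsilon>..\<epsilon>} \<inter> {0..1} = {1 - \<epsilon>..\<epsilon>}" using \<epsilon> by auto
    then show ?thesis using unif_sample_component_prob[OF one, of "{1 - \<epsilon>..\<epsilon>}"] \<epsilon> by simp
  qed
  ultimately have B: "space (unif_sample N) - ?A \<in> sets (unif_sample N)"
    "S.prob (space (unif_sample N) - ?A) < \<delta>"
    using S.prob_compl[of ?A] \<epsilon> \<delta> by auto
  show ?thesis
  proof (rule unif_sample_prob_gtI[OF num_clusters_sample_events(2) B])
    fix x assume "x \<notin> space (unif_sample N) - ?A" "x \<in> space (unif_sample N)"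
      and inj: "inj_on x {1..N}" and range: "\<forall>i\<in>{1..N}. x i \<in> {0..1}"
    then have "1 - \<epsilon> \<le> x 1" "x 1 \<le> \<epsilon>" by auto
    then show "num_clusters (x ` {1..N}) \<epsilon> m = 1"
      by (rule one_cluster_centre[OF inj range m(1) one])
  qed
qed

text \<open>Now \<open>{1 - \<epsilon>..\<epsilon>}\<close> covers [0,1], so any sample point is a
  centre and the bad event is empty.\<close>

lemma one_cluster_probability_diameter:
  fixes \<delta> \<epsilon> :: real
  assumes "0 < \<delta>" "1 \<le> \<epsilon>" and m: "m \<le> N" "0 < N"
  shows "\<P>(x in unif_sample N. num_clusters (x ` {1..N}) \<epsilon> m = 1) > 1 - \<delta>"
proof (rule unif_sample_prob_gtI[OF num_clusters_sample_events(2), of "{}"])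
  fix x :: "nat \<Rightarrow> real" assume x: "inj_on x {1..N}" "\<forall>i\<in>{1..N}. x i \<in> {0..1}"
  have one: "1 \<in> {1..N}" using m by simp
  with x(2) have "x 1 \<in> {0..1}" by blast
  then have "1 - \<epsilon> \<le> x 1" "x 1 \<le> \<epsilon>" using assms(2) by auto
  then show "num_clusters (x ` {1..N}) \<epsilon> m = 1"
    by (rule one_cluster_centre[OF x m(1) one])
qed (use assms in auto)

theorem theorem2:
  "\<exists>C::real. C > 0 \<and>
     (\<forall>(\<rho>::real) (\<beta>::real) (\<delta>::real) (q::real).
        0 < \<rho> \<and> \<rho> < 1 / 4 \<and> \<beta> > 1 \<and> \<delta> > 0 \<and> q = 1 - 1 / sqrt \<beta> \<longrightarrow>
          (\<forall>(\<epsilon>::real) (N::nat) (MinPts::nat).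
             \<epsilon> > \<beta> * (\<rho> / 2) \<and> real N > sample_bound C \<rho> q \<delta> \<epsilon> \<and>
             real MinPts = \<rho> * real N \<and> MinPts \<ge> 2 \<longrightarrow>
             \<P>(x in unif_sample N. num_clusters (x ` {1..N}) \<epsilon> MinPts = 1) > 1 - \<delta>) \<and>
          (\<forall>(\<epsilon>::real) (N::nat) (MinPts::nat).
             0 < \<epsilon> \<and> \<epsilon> < (1 / \<beta>) * (\<rho> / 2) \<and> real N > sample_bound C \<rho> q \<delta> \<epsilon> \<and>
             real MinPts = \<rho> * real N \<and> MinPts \<ge> 2 \<longrightarrow>
             \<P>(x in unif_sample N. num_clusters (x ` {1..N}) \<epsilon> MinPts = 0) > 1 - \<delta>))"
proof (intro exI[of _ 320] conjI allI impI; (elim conjE)?)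
  show "(0::real) < 320" by simp
next
  fix \<rho> \<beta> \<delta> q \<epsilon> :: real and N m :: nat
  assume \<rho>: "0 < \<rho>" "\<rho> < 1 / 4" and \<beta>: "1 < \<beta>" and \<delta>: "0 < \<delta>" and q_def: "q = 1 - 1 / sqrt \<beta>"
    and \<epsilon>: "\<beta> * (\<rho> / 2) < \<epsilon>" and N: "sample_bound 320 \<rho> q \<delta> \<epsilon> < real N"
    and m: "real m = \<rho> * real N" "2 \<le> m"
  have q: "0 < q" "q < 1" using \<beta> by (auto simp: q_def)
  \<comment> \<open>The choice of \<open>q\<close> makes \<open>(1 - q)\<^sup>2\<close> the
    reciprocal of \<open>\<beta>\<close>, so the threshold becomes a polynomial condition in
    \<open>q\<close>.\<close>
  have sq: "(1 - q)\<^sup>2 = 1 / \<beta>" using \<beta> by (simp add: q_def power_divide)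
  have "real m \<le> N" unfolding m using \<rho> by (simp add: mult_left_le_one_le)
  with m have mN: "m \<le> N" "0 < N" by auto
  have \<epsilon>0: "0 < \<epsilon>" using \<epsilon> \<rho> \<beta> by (smt (verit) divide_pos_pos mult_pos_pos)
  \<comment> \<open>For \<open>1 < \<delta>\<close> a probability only has to exceed a negative
    number. In the last case all three factors are at most 1, so \<delta> and \<epsilon> each exceed
    2/3.\<close>
  consider "1 < \<delta>" | "1 \<le> \<epsilon>" | "\<delta> \<le> 1" "\<epsilon> \<le> 1 / 2" | "\<epsilon> < 1" "1 / 2 \<le> \<epsilon>" "\<delta> * \<epsilon> * q \<le> 2 / 3"
    | "\<delta> \<le> 1" "\<epsilon> < 1" "2 / 3 < \<delta> * \<epsilon> * q" by linarith
  then show "\<P>(x in unif_sample N. num_clusters (x ` {1..N}) \<epsilon> m = 1) > 1 - \<delta>"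
  proof cases
    case 1
    then show ?thesis by (intro less_le_trans[OF _ measure_nonneg]) simp
  next
    case 2
    show ?thesis by (rule one_cluster_probability_diameter[OF \<delta> 2 mN])
  next
    case 3
    have "\<rho> < 2 * \<epsilon> * (1 - q)\<^sup>2" unfolding sq using \<epsilon> \<beta> by (simp add: field_simps)
    with 3 show ?thesis by (intro one_cluster_probability_small[OF q \<rho>(1) \<delta> _ _ _ N m(1)])
  next
    case 4
    show ?thesis by (rule one_cluster_probability_wide[OF q \<rho> \<delta> 4(2,1,3) N m])
  next
    case 5
    have "\<delta> * \<epsilon> * q \<le> \<delta>" "\<delta> * \<epsilon> * q \<le> \<epsilon>"
      using 5 \<delta> \<epsilon>0 q mult_mono[of "\<delta> * \<epsilon>" \<delta> q 1] mult_mono[of "\<delta> * \<epsilon>" \<epsilon> q 1]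
      by (auto simp: mult_left_le mult_left_le_one_le)
    with 5 show ?thesis by (intro one_cluster_probability_centre[OF _ _ _ mN]) linarith+
  qed
next
  fix \<rho> \<beta> \<delta> q \<epsilon> :: real and N m :: nat
  assume \<rho>: "0 < \<rho>" "\<rho> < 1 / 4" and \<beta>: "1 < \<beta>" and \<delta>: "0 < \<delta>" and q_def: "q = 1 - 1 / sqrt \<beta>"
    and \<epsilon>: "0 < \<epsilon>" "\<epsilon> < 1 / \<beta> * (\<rho> / 2)" and N: "sample_bound 320 \<rho> q \<delta> \<epsilon> < real N"
    and m: "real m = \<rho> * real N" "2 \<le> m"
  have q: "0 < q" "q < 1" using \<beta> by (auto simp: q_def)
  have sq: "(1 - q)\<^sup>2 = 1 / \<beta>" using \<beta> by (simp add: q_def power_divide)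
  show "\<P>(x in unif_sample N. num_clusters (x ` {1..N}) \<epsilon> m = 0) > 1 - \<delta>"
  proof (cases "1 < \<delta>")
    case True
    then show ?thesis by (intro less_le_trans[OF _ measure_nonneg]) simp
  next
    case False
    moreover have "2 * \<epsilon> < \<rho> * (1 - q)\<^sup>2" unfolding sq using \<epsilon> by (simp add: field_simps)
    ultimately show ?thesis by (intro no_clusters_probability[OF q \<rho> \<delta> _ \<epsilon>(1) _ N m(1)]) auto
  qed
qed

end
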